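(* Let $X$ be a multigraph (multiple edges allowed) with no isolated vertices and let $\mathrm{TR}(X)$ be a generalized truncation of $X$ with maximum valency $\Delta$. If every constituent $\mathrm{con}(v)$ of $\mathrm{TR}(X)$ that contains a vertex of valency $\Delta$ in $\mathrm{TR}(X)$ is class I (as a graph in its own right), then $\mathrm{TR}(X)$ is class I.
   Context: Generalized truncation of $X$: for each edge $e=[u,v]$ of $X$ take a new edge (these form a matching $M_F$) whose two ends are labelled $u$ and $v$. For each vertex $v$ of $X$, the cluster $\mathrm{cl}(v)$ is the set of ends labelled $v$; insert an arbitrary simple graph $\mathrm{con}(v)$ (the constituent at $v$) on $\mathrm{cl}(v)$. The graph $\mathrm{TR}(X)=M_F\cup\bigcup_v\mathrm{con}(v)$ is a generalized truncation. A graph is class I if its chromatic index (minimum number of colors in a proper edge coloring) equals its maximum valency. *)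

theory Defs
  imports Main
begin

text \<open>Simple undirected graphs; an edge is the two-element set of its ends.\<close>

record 'a graph =
  verts :: "'a set"
  edges :: "'a set set"

definition simple_graph :: "'a graph \<Rightarrow> bool" where
  "simple_graph G \<longleftrightarrow>
     finite (verts G) \<and> (\<forall>e \<in> edges G. e \<subseteq> verts G \<and> card e = 2)"

definition valency :: "'a graph \<Rightarrow> 'a \<Rightarrow> nat" where
  "valency G x = card {e \<in> edges G. x \<in> e}"

text \<open>The inserted \<open>0\<close> only matters for the graph without vertices.\<close>

definition max_valency :: "'a graph \<Rightarrow> nat" where
  "max_valency G = Max (insert 0 (valency G ` verts G))"

definition proper_edge_coloring :: "'a graph \<Rightarrow> ('a set \<Rightarrow> 'c) \<Rightarrow> bool" where
  "proper_edge_coloring G c \<longleftrightarrow>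
     (\<forall>d \<in> edges G. \<forall>e \<in> edges G. d \<noteq> e \<and> d \<inter> e \<noteq> {} \<longrightarrow> c d \<noteq> c e)"

definition edge_colorable :: "'a graph \<Rightarrow> nat \<Rightarrow> bool" where
  "edge_colorable G k \<longleftrightarrow>
     (\<exists>c :: 'a set \<Rightarrow> nat. proper_edge_coloring G c \<and> c ` edges G \<subseteq> {..<k})"

definition chromatic_index :: "'a graph \<Rightarrow> nat" where
  "chromatic_index G = (LEAST k. edge_colorable G k)"

definition class_I :: "'a graph \<Rightarrow> bool" where
  "class_I G \<longleftrightarrow> chromatic_index G = max_valency G"

text \<open>Finite multigraphs: edges are abstract objects carrying a two-element set of
  ends, so parallel edges are allowed and loops are not.\<close>

record ('v, 'e) mgraph =
  mverts :: "'v set"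
  medges :: "'e set"
  mends :: "'e \<Rightarrow> 'v set"

definition multigraph :: "('v, 'e) mgraph \<Rightarrow> bool" where
  "multigraph X \<longleftrightarrow> finite (mverts X) \<and> finite (medges X) \<and>
     (\<forall>e \<in> medges X. mends X e \<subseteq> mverts X \<and> card (mends X e) = 2)"

definition no_isolated_vertices :: "('v, 'e) mgraph \<Rightarrow> bool" where
  "no_isolated_vertices X \<longleftrightarrow> (\<forall>v \<in> mverts X. \<exists>e \<in> medges X. v \<in> mends X e)"

text \<open>The new edge that replaces \<open>e = [u, v]\<close> joins \<open>(e, u)\<close> and \<open>(e, v)\<close>: a vertex
  \<open>(e, u)\<close> of the truncation is the end labelled \<open>u\<close> of that new edge.\<close>

definition matching_edge :: "('v, 'e) mgraph \<Rightarrow> 'e \<Rightarrow> ('e \<times> 'v) set" where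
  "matching_edge X e = {(e, u) |u. u \<in> mends X e}"

definition fundamental_matching :: "('v, 'e) mgraph \<Rightarrow> ('e \<times> 'v) set set" where
  "fundamental_matching X = matching_edge X ` medges X"

definition cluster :: "('v, 'e) mgraph \<Rightarrow> 'v \<Rightarrow> ('e \<times> 'v) set" where
  "cluster X v = {(e, v) |e. e \<in> medges X \<and> v \<in> mends X e}"

definition constituents :: "('v, 'e) mgraph \<Rightarrow> ('v \<Rightarrow> ('e \<times> 'v) graph) \<Rightarrow> bool" where
  "constituents X con \<longleftrightarrow>
     (\<forall>v \<in> mverts X. simple_graph (con v) \<and> verts (con v) = cluster X v)"

definition TR :: "('v, 'e) mgraph \<Rightarrow> ('v \<Rightarrow> ('e \<times> 'v) graph) \<Rightarrow> ('e \<times> 'v) graph" where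
  "TR X con =
     \<lparr>verts = (\<Union>(fundamental_matching X)),
      edges = fundamental_matching X \<union> (\<Union>v \<in> mverts X. edges (con v))\<rparr>"

lemma simple_graph_TR:
  assumes X: "multigraph X" and con: "constituents X con"
  shows "simple_graph (TR X con)"
proof -
  have me: "matching_edge X e = Pair e ` mends X e" for e
    by (auto simp: matching_edge_def)
  have fin: "finite (mends X e)" if "e \<in> medges X" for e
    using X that by (metis multigraph_def finite_subset)
  have "finite (verts (TR X con))"
    using X fin by (auto simp: TR_def fundamental_matching_def me multigraph_def)
  moreover have "d \<subseteq> verts (TR X con) \<and> card d = 2" if "d \<in> fundamental_matching X" for d
    using X that
    by (auto simp: TR_def fundamental_matching_def me multigraph_def card_image inj_on_def)
  moreover have "d \<subseteq> verts (TR X con) \<and> card d = 2"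
    if v: "v \<in> mverts X" and d: "d \<in> edges (con v)" for v d
  proof -
    have "cluster X v \<subseteq> verts (TR X con)"
      by (auto simp: TR_def fundamental_matching_def matching_edge_def cluster_def)
    then show ?thesis
      using con v d unfolding constituents_def simple_graph_def by blast
  qed
  moreover have "edges (TR X con) = fundamental_matching X \<union> (\<Union>v \<in> mverts X. edges (con v))"
    by (simp add: TR_def)
  ultimately show ?thesis
    unfolding simple_graph_def by blast
qed

lemma verts_TR:
  assumes "multigraph X"
  shows "verts (TR X con) = (\<Union>v \<in> mverts X. cluster X v)"
  using assms
  by (fastforce simp: TR_def fundamental_matching_def matching_edge_def cluster_def multigraph_def)

end

theory Submission
  imports Defs "HOL-Combinatorics.Transposition"
begin

text \<open>Reserve one colour for the fundamental matching. Every vertex of the truncation is covered by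
  it exactly once, so constituents that meet a vertex of valency \<open>\<Delta>\<close> have maximum
  valency \<open>\<Delta> - 1\<close> and are class I, while the other ones have maximum valency
  at most \<open>\<Delta> - 2\<close>; the latter are coloured with \<open>\<Delta> - 1\<close> colours by Vizing's theorem.

  Vizing's theorem is shown by adding one edge \<open>{x, y}\<close> at a time, with a maximal fan at \<open>x\<close>
  starting with \<open>y\<close>. If its last colour \<open>d\<close> is not missing at \<open>x\<close>, then two vertices of the fan
  miss \<open>d\<close>, and at most one of them is in the Kempe chain that starts at \<open>x\<close>. Swapping
  colours on that chain makes \<open>d\<close> missing at \<open>x\<close> and keeps the fan up to the other vertex.\<close>

section \<open>Kempe chains\<close>

text \<open>View \<open>a\<close> and \<open>b\<close> as two matchings, a fixed point being an
  unmatched vertex. Components of their union are paths and cycles; \<open>S\<close> is the path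
  with end \<open>x\<close>, so it has at most one other end.\<close>

lemma two_involutions_orbit:
  fixes a b :: "'a \<Rightarrow> 'a"
  assumes a: "\<And>z. a (a z) = z" and b: "\<And>z. b (b z) = z" and x: "b x = x"
  obtains S where "x \<in> S" "a ` S \<subseteq> S" "b ` S \<subseteq> S"
    "\<And>y z. \<lbrakk>y \<in> S; z \<in> S; y \<noteq> x; z \<noteq> x; a y = y \<or> b y = y; a z = z \<or> b z = z\<rbrakk> \<Longrightarrow> y = z"
proof -
  \<comment> \<open>The walk \<open>w\<close> applies \<open>a\<close> and \<open>b\<close> alternately and turns back at the first fixed point it meets
    after \<open>x\<close>, so the whole orbit has been visited by then.\<close>
  define w where "w = rec_nat x (\<lambda>n. if even n then a else b)"
  have w0: "w 0 = x" and wS: "\<And>n. w (Suc n) = (if even n then a else b) (w n)"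
    by (simp_all add: w_def)
  have backward: "(if even n then a else b) (w (Suc n)) = w n" for n
    by (simp add: wS a b)
  \<comment> \<open>At \<open>n = 0\<close> truncated subtraction makes \<open>w (n - 1)\<close>
    equal to \<open>x\<close>, which is right because \<open>b\<close> fixes
    \<open>x\<close>.\<close>
  have nbr: "{a (w n), b (w n)} = {w (n - 1), w (Suc n)}" for n
  proof (cases n)
    case 0
    then show ?thesis using x w0 wS[of 0] by auto
  next
    case (Suc m)
    then show ?thesis using backward[of m] wS[of n] by auto
  qed
  have first: "\<exists>n. w n = y \<and> range w \<subseteq> w ` {..n} \<and> (\<forall>i<n. w i \<noteq> y)"
    if y: "y \<in> range w" "y \<noteq> x" and fixed: "a y = y \<or> b y = y" for y
  proof -
    define n where "n = (LEAST n. w n = y)"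
    have n: "w n = y" unfolding n_def using y(1) by (auto intro: LeastI)
    have least: "\<forall>i<n. w i \<noteq> y" unfolding n_def using not_less_Least by blast
    have "n > 0" using n w0 y(2) by (cases n) auto
    then have "w (n - 1) \<noteq> y" using least by simp
    \<comment> \<open>A fixed point is its own neighbour on the walk. As \<open>n\<close> is the
      first visit, that neighbour is the next step and not the previous one.\<close>
    moreover have "y \<in> {w (n - 1), w (Suc n)}"
      using fixed n unfolding nbr[of n, symmetric] by auto
    ultimately have stop: "w (Suc n) = w n" using n by simp
    have "w m \<in> w ` {..n}" for m
    proof (induction m)
      case (Suc m)
      then obtain i where i: "i \<le> n" "w m = w i" by auto
      have "w (Suc m) \<in> {w (i - 1), w (Suc i)}"
        unfolding nbr[of i, symmetric] by (simp add: wS i(2))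
      moreover have "w (Suc i) \<in> w ` {..n}"
      proof (cases "i = n")
        case True
        then show ?thesis using stop by (metis atMost_iff imageI order_refl)
      next
        case False
        then show ?thesis using i(1) by (intro imageI) simp
      qed
      moreover have "w (i - 1) \<in> w ` {..n}" using i(1) by (intro imageI) simp
      ultimately show ?case by (metis empty_iff insert_iff)
    qed simp
    then show ?thesis using n least by blast
  qed
  show thesis
  proof (rule that[of "range w"])
    show "x \<in> range w" using w0 by (metis rangeI)
    show "a ` range w \<subseteq> range w" "b ` range w \<subseteq> range w" using nbr by blast+
  next
    fix y z
    assume yz: "y \<in> range w" "z \<in> range w" "y \<noteq> x" "z \<noteq> x" "a y = y \<or> b y = y" "a z = z \<or> b z = z"
    obtain m where m: "w m = y" "range w \<subseteq> w ` {..m}" "\<forall>i<m. w i \<noteq> y"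
      using first yz by metis
    obtain n where n: "w n = z" "range w \<subseteq> w ` {..n}" "\<forall>i<n. w i \<noteq> z"
      using first yz by metis
    \<comment> \<open>By time \<open>n\<close> the walk has covered the whole orbit, so
      \<open>y\<close> has been met; by symmetry the two times agree.\<close>
    have "m \<le> n"
    proof (rule ccontr)
      assume "\<not> m \<le> n"
      then have "w i \<noteq> y" if "i \<le> n" for i using m(3) that by simp
      then have "y \<notin> w ` {..n}" by auto
      then show False using n(2) yz(1) by blast
    qed
    moreover have "n \<le> m"
    proof (rule ccontr)
      assume "\<not> n \<le> m"
      then have "w i \<noteq> z" if "i \<le> m" for i using n(3) that by simp
      then have "z \<notin> w ` {..m}" by auto
      then show False using m(2) yz(2) by blast
    qed
    ultimately show "y = z" using m(1) n(1) by simp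
  qed
qed

text \<open>Takes a bare edge set because the arguments below remove and restore single
  edges.\<close>

definition proper_on :: "'a set set \<Rightarrow> ('a set \<Rightarrow> 'c) \<Rightarrow> bool" where
  "proper_on F f \<longleftrightarrow> (\<forall>d \<in> F. \<forall>e \<in> F. d \<noteq> e \<and> d \<inter> e \<noteq> {} \<longrightarrow> f d \<noteq> f e)"

definition missing :: "'a set set \<Rightarrow> ('a set \<Rightarrow> 'c) \<Rightarrow> 'a \<Rightarrow> 'c \<Rightarrow> bool" where
  "missing F f z k \<longleftrightarrow> (\<forall>e \<in> F. z \<in> e \<longrightarrow> f e \<noteq> k)"

text \<open>A vertex missing the colour is its own partner, so a colour class of a proper colouring
  becomes a total involution, as \<open>two_involutions_orbit\<close> requires.\<close>

definition partner :: "'a set set \<Rightarrow> ('a set \<Rightarrow> 'c) \<Rightarrow> 'c \<Rightarrow> 'a \<Rightarrow> 'a" where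
  "partner F f k z = (if missing F f z k then z else SOME y. {z, y} \<in> F \<and> f {z, y} = k)"

lemma card_2_other_end:
  assumes "card e = 2" "z \<in> e"
  obtains y where "e = {z, y}" "y \<noteq> z"
  using assms by (auto simp: card_2_iff)

lemma proper_on_inj:
  assumes "proper_on F f" "{z, y} \<in> F" "{z, y'} \<in> F" "f {z, y} = f {z, y'}"
  shows "y = y'"
proof -
  have "{z, y} \<inter> {z, y'} \<noteq> {}" by simp
  then have "{z, y} = {z, y'}" using assms unfolding proper_on_def by metis
  then show ?thesis by (auto simp: doubleton_eq_iff)
qed

lemma partner_eq:
  assumes "proper_on F f" "{z, y} \<in> F" "f {z, y} = k"
  shows "partner F f k z = y"
proof -
  have "\<not> missing F f z k" using assms by (auto simp: missing_def)
  moreover have "(SOME y. {z, y} \<in> F \<and> f {z, y} = k) = y"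
    using assms by (intro some_equality) (auto dest: proper_on_inj)
  ultimately show ?thesis by (simp add: partner_def)
qed

lemma not_missingE:
  assumes "\<forall>e \<in> F. card e = 2" "\<not> missing F f z k"
  obtains y where "{z, y} \<in> F" "f {z, y} = k" "y \<noteq> z"
  using assms card_2_other_end unfolding missing_def by metis

lemma partner_involution:
  assumes "\<forall>e \<in> F. card e = 2" "proper_on F f"
  shows "partner F f k (partner F f k z) = z"
proof (cases "missing F f z k")
  case True
  then show ?thesis by (simp add: partner_def)
next
  case False
  then obtain y where "{z, y} \<in> F" "f {z, y} = k" using assms not_missingE by metis
  moreover from this have "{y, z} \<in> F" "f {y, z} = k" by (simp_all add: insert_commute)
  ultimately show ?thesis using assms partner_eq by metis
qed

text \<open>The chain is the orbit of \<open>x\<close> under the partners in colours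
  \<open>d\<close> and \<open>c\<close>; \<open>x\<close> is an end because it misses
  \<open>c\<close>. Any other vertex missing \<open>d\<close> is a fixed point, hence the other
  end.\<close>

lemma kempe_chain:
  assumes two: "\<forall>e \<in> F. card e = 2" and f: "proper_on F f" and c: "missing F f x c"
  obtains S where "x \<in> S"
    "\<And>e. \<lbrakk>e \<in> F; f e \<in> {c, d}; e \<inter> S \<noteq> {}\<rbrakk> \<Longrightarrow> e \<subseteq> S"
    "\<And>y z. \<lbrakk>y \<in> S; z \<in> S; y \<noteq> x; z \<noteq> x; missing F f y d; missing F f z d\<rbrakk> \<Longrightarrow> y = z"
proof -
  have stay: "partner F f k z = z" if "missing F f z k" for k z
    using that by (simp add: partner_def)
  show thesis
  proof (rule two_involutions_orbit[of "partner F f d" "partner F f c" x])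
    show "partner F f d (partner F f d z) = z" "partner F f c (partner F f c z) = z" for z
      using partner_involution[OF two f] by simp_all
    show "partner F f c x = x" using c by (rule stay)
  next
    fix S
    assume S: "x \<in> S" "partner F f d ` S \<subseteq> S" "partner F f c ` S \<subseteq> S"
      "\<And>y z. \<lbrakk>y \<in> S; z \<in> S; y \<noteq> x; z \<noteq> x; partner F f d y = y \<or> partner F f c y = y;
        partner F f d z = z \<or> partner F f c z = z\<rbrakk> \<Longrightarrow> y = z"
    show thesis
    proof (rule that[of S])
      show "x \<in> S" by fact
      fix e assume e: "e \<in> F" "f e \<in> {c, d}" "e \<inter> S \<noteq> {}"
      then obtain z where z: "z \<in> e" "z \<in> S" by blast
      then obtain y where y: "e = {z, y}" using two e(1) card_2_other_end by metis
      then have "partner F f c z = y \<or> partner F f d z = y" using e(1,2) partner_eq[OF f] by auto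
      then have "y \<in> S" using S(2,3) z(2) by blast
      then show "e \<subseteq> S" using y z by simp
    next
      fix y z assume "y \<in> S" "z \<in> S" "y \<noteq> x" "z \<noteq> x" "missing F f y d" "missing F f z d"
      then show "y = z" using S(4)[of y z] stay[of y d] stay[of z d] by simp
    qed
  qed
qed

text \<open>Edges with only one end in \<open>S\<close> are transposed too. This is harmless for a
  chain, since such edges carry neither \<open>c\<close> nor \<open>d\<close>.\<close>

definition kempe_swap :: "'c \<Rightarrow> 'c \<Rightarrow> 'a set \<Rightarrow> ('a set \<Rightarrow> 'c) \<Rightarrow> 'a set \<Rightarrow> 'c" where
  "kempe_swap c d S f e = (if e \<inter> S = {} then f e else transpose c d (f e))"

text \<open>Seen from a single vertex, the swap is one permutation of the colours. Its injectivity
  then gives properness, and its being an involution gives the missing colours.\<close>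

lemma kempe_swap_at:
  assumes closed: "\<And>e. \<lbrakk>e \<in> F; f e \<in> {c, d}; e \<inter> S \<noteq> {}\<rbrakk> \<Longrightarrow> e \<subseteq> S"
    and "e \<in> F" "z \<in> e"
  shows "kempe_swap c d S f e = (if z \<in> S then transpose c d (f e) else f e)"
proof (cases "f e \<in> {c, d}")
  case True
  then show ?thesis using assms closed[of e] by (auto simp: kempe_swap_def)
next
  case False
  then show ?thesis by (simp add: kempe_swap_def)
qed

lemma proper_on_kempe_swap:
  assumes closed: "\<And>e. \<lbrakk>e \<in> F; f e \<in> {c, d}; e \<inter> S \<noteq> {}\<rbrakk> \<Longrightarrow> e \<subseteq> S"
    and "proper_on F f"
  shows "proper_on F (kempe_swap c d S f)"
  unfolding proper_on_def
proof (intro ballI impI, elim conjE)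
  fix g e assume ge: "g \<in> F" "e \<in> F" "g \<noteq> e" "g \<inter> e \<noteq> {}"
  then obtain z where z: "z \<in> g" "z \<in> e" by blast
  have "f g \<noteq> f e" using ge assms(2) by (simp add: proper_on_def)
  moreover have "kempe_swap c d S f g = (if z \<in> S then transpose c d (f g) else f g)"
    using closed ge(1) z(1) by (rule kempe_swap_at)
  moreover have "kempe_swap c d S f e = (if z \<in> S then transpose c d (f e) else f e)"
    using closed ge(2) z(2) by (rule kempe_swap_at)
  ultimately show "kempe_swap c d S f g \<noteq> kempe_swap c d S f e"
    by (simp add: inj_eq[OF inj_transpose])
qed

lemma missing_kempe_swap:
  assumes closed: "\<And>e. \<lbrakk>e \<in> F; f e \<in> {c, d}; e \<inter> S \<noteq> {}\<rbrakk> \<Longrightarrow> e \<subseteq> S"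
  shows "missing F (kempe_swap c d S f) z k \<longleftrightarrow>
    missing F f z (if z \<in> S then transpose c d k else k)"
proof -
  have "kempe_swap c d S f e = k \<longleftrightarrow> f e = (if z \<in> S then transpose c d k else k)"
    if "e \<in> F" "z \<in> e" for e
  proof -
    have "kempe_swap c d S f e = (if z \<in> S then transpose c d (f e) else f e)"
      using closed that by (rule kempe_swap_at)
    then show ?thesis by (simp split: if_split) (metis transpose_involutory)
  qed
  then show ?thesis unfolding missing_def by blast
qed

section \<open>Vizing's theorem\<close>

text \<open>\<open>{x, hd ys}\<close> is the edge without a colour. Each vertex misses the colour of
  the next spoke, so colours can be moved one spoke towards the head.\<close>

definition fan :: "'a set set \<Rightarrow> ('a set \<Rightarrow> 'c) \<Rightarrow> 'a \<Rightarrow> 'a list \<Rightarrow> bool" where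
  "fan E f x ys \<longleftrightarrow> ys \<noteq> [] \<and> distinct ys \<and> (\<forall>y \<in> set ys. {x, y} \<in> E) \<and>
     (\<forall>i. Suc i < length ys \<longrightarrow> missing (E - {{x, hd ys}}) f (ys ! i) (f {x, ys ! Suc i}))"

lemma proper_on_insert:
  assumes "proper_on F f" "\<And>e. \<lbrakk>e \<in> F; e \<inter> d \<noteq> {}\<rbrakk> \<Longrightarrow> f e \<noteq> k" "d \<notin> F"
  shows "proper_on (insert d F) (f(d := k))"
  unfolding proper_on_def
proof (intro ballI impI, elim conjE)
  fix g e assume ge: "g \<in> insert d F" "e \<in> insert d F" "g \<noteq> e" "g \<inter> e \<noteq> {}"
  then consider "g = d" "e \<in> F" "e \<noteq> d" | "e = d" "g \<in> F" "g \<noteq> d" | "g \<in> F" "e \<in> F" "g \<noteq> d" "e \<noteq> d"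
    using assms(3) by blast
  then show "(f(d := k)) g \<noteq> (f(d := k)) e"
  proof cases
    case 1
    then have "f e \<noteq> k" using assms(2)[of e] ge(4) by (simp add: Int_commute)
    then show ?thesis using 1 by simp
  next
    case 2
    then have "f g \<noteq> k" using assms(2)[of g] ge(4) by simp
    then show ?thesis using 2 by simp
  next
    case 3
    then have "f g \<noteq> f e" using assms(1) ge(3,4) by (simp add: proper_on_def)
    then show ?thesis using 3 by simp
  qed
qed

lemma proper_on_subset: "\<lbrakk>proper_on F f; F' \<subseteq> F\<rbrakk> \<Longrightarrow> proper_on F' f"
  unfolding proper_on_def by blast

text \<open>Giving the first spoke the colour of the second moves the uncoloured edge one step along
  the fan; once it reaches the last vertex, \<open>d\<close> is free at both ends.\<close>

lemma fan_shift:
  assumes "\<forall>e \<in> E. card e = 2"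
    and "proper_on (E - {{x, hd ys}}) f" "f ` (E - {{x, hd ys}}) \<subseteq> C"
    and "fan E f x ys" "d \<in> C"
    and "missing (E - {{x, hd ys}}) f x d" "missing (E - {{x, hd ys}}) f (last ys) d"
  shows "\<exists>g. proper_on E g \<and> g ` E \<subseteq> C"
  using assms(2-)
proof (induction ys arbitrary: f)
  case Nil
  then show ?case by (simp add: fan_def)
next
  case (Cons y ys)
  let ?F = "E - {{x, y}}"
  have xy: "{x, y} \<in> E" using Cons.prems(3) by (simp add: fan_def)
  then have "x \<noteq> y" using assms(1) by fastforce
  show ?case
  proof (cases ys)
    case Nil
    let ?g = "f({x, y} := d)"
    have m: "missing ?F f x d" "missing ?F f y d" using Cons.prems Nil by simp_all
    have "proper_on (insert {x, y} ?F) ?g"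
      using Cons.prems(1) m by (intro proper_on_insert) (auto simp: missing_def)
    then have "proper_on E ?g" using xy by (simp only: insert_Diff)
    moreover have "?g ` E \<subseteq> C" using Cons.prems(2,4) by auto
    ultimately show ?thesis by blast
  next
    case (Cons y' zs)
    \<comment> \<open>\<open>?g\<close> keeps the old value on \<open>{x, y'}\<close>, but that is
      now the uncoloured edge and is left out of \<open>?F'\<close>.\<close>
    let ?g = "f({x, y} := f {x, y'})" and ?F' = "E - {{x, y'}}"
    have fan: "fan E f x (y # y' # zs)" using Cons.prems(3) Cons by simp
    then have distinct: "y \<noteq> y'" "y \<notin> set zs" "y' \<notin> set zs" and "{x, y'} \<in> E"
      by (simp_all add: fan_def)
    then have xy': "{x, y'} \<in> ?F" by (simp add: doubleton_eq_iff)
    have step: "missing ?F f ((y # y' # zs) ! i) (f {x, (y' # zs) ! i})" if "i < length (y' # zs)" for i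
      using fan that unfolding fan_def by simp
    have m: "missing ?F f y (f {x, y'})" using step[of 0] by simp
    \<comment> \<open>At \<open>x\<close> properness reserves this colour for
      \<open>{x, y'}\<close>; at \<open>y\<close> it is missing.\<close>
    have neq: "f e \<noteq> f {x, y'}" if "e \<in> ?F" "e \<noteq> {x, y'}" "e \<inter> {x, y} \<noteq> {}" for e
    proof (cases "x \<in> e")
      case True
      then have "e \<inter> {x, y'} \<noteq> {}" by blast
      then show ?thesis using that xy' Cons.prems(1) by (simp add: proper_on_def)
    next
      case False
      then show ?thesis using that m unfolding missing_def by blast
    qed
    have "proper_on (insert {x, y} (?F - {{x, y'}})) ?g"
      using Cons.prems(1) neq by (intro proper_on_insert) (auto intro: proper_on_subset)
    moreover have "insert {x, y} (?F - {{x, y'}}) = ?F'" using xy xy' by blast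
    ultimately have "proper_on ?F' ?g" by (simp only:)
    moreover have "?g ` ?F' \<subseteq> C" using Cons.prems(2) xy' by auto
    \<comment> \<open>The recoloured edge touches only \<open>x\<close> and \<open>y\<close>, so
      every other vertex keeps its missing colours.\<close>
    moreover have miss: "missing ?F' ?g z k" if "missing ?F f z k" "z \<notin> {x, y}" for z k
      using that by (auto simp: missing_def)
    moreover have "fan E ?g x (y' # zs)"
      unfolding fan_def
    proof (intro conjI allI impI)
      fix i assume i: "Suc i < length (y' # zs)"
      let ?u = "(y' # zs) ! i" and ?v = "(y' # zs) ! Suc i"
      have "?u \<in> set (y' # zs)" using i by (intro nth_mem) simp
      moreover have "{x, ?u} \<in> E" using calculation fan by (auto simp: fan_def)
      then have "?u \<noteq> x" using assms(1) by fastforce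
      moreover have "?v \<in> set zs" using i by simp
      moreover have "missing ?F f ?u (f {x, ?v})"
        using step[of "Suc i"] i by simp
      moreover have ne: "w \<noteq> y" if "w \<in> set (y' # zs)" for w using distinct that by auto
      have "?u \<noteq> y" "?v \<noteq> y" using i by (intro ne nth_mem; simp)+
      ultimately show "missing (E - {{x, hd (y' # zs)}}) ?g ?u (?g {x, ?v})"
        using miss[of ?u "f {x, ?v}"] \<open>x \<noteq> y\<close> by (simp add: doubleton_eq_iff)
    qed (use fan in \<open>auto simp: fan_def\<close>)
    \<comment> \<open>\<open>x\<close> gains no colour: \<open>{x, y}\<close> takes over the one of
      \<open>{x, y'}\<close>, which is not \<open>d\<close>.\<close>
    moreover have "missing ?F' ?g x d"
      using Cons.prems(5) xy' by (auto simp: missing_def)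
    moreover have "missing ?F' ?g (last (y' # zs)) d"
    proof (rule miss)
      show "missing ?F f (last (y' # zs)) d" using Cons.prems(6) Cons by simp
      have "last (y' # zs) \<in> set (y' # zs)" by (intro last_in_set) simp
      moreover from this have "{x, last (y' # zs)} \<in> E" using fan unfolding fan_def
        by (meson list.set_intros(2))
      then have "last (y' # zs) \<noteq> x" using assms(1) by fastforce
      ultimately show "last (y' # zs) \<notin> {x, y}" using distinct by auto
    qed
    ultimately show ?thesis using Cons.IH[of ?g, unfolded Cons list.sel] Cons.prems(4) by (simp only: list.sel)
  qed
qed

lemma exists_missing:
  assumes "finite F" "card {e \<in> F. z \<in> e} < k"
  obtains c where "c < k" "missing F f z c"
proof -
  have "card (f ` {e \<in> F. z \<in> e}) < card {..<k}"
    using assms card_image_le[of "{e \<in> F. z \<in> e}" f] by simp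
  then have "\<not> {..<k} \<subseteq> f ` {e \<in> F. z \<in> e}"
    using assms(1) card_mono[of "f ` {e \<in> F. z \<in> e}" "{..<k}"] by fastforce
  then show thesis using that by (auto simp: missing_def)
qed

lemma extend_coloring:
  fixes f :: "'a set \<Rightarrow> nat"
  assumes fin: "finite E" and two: "\<forall>e \<in> E. card e = 2"
    and deg: "\<And>z. card {e \<in> E. z \<in> e} < k"
    and xy: "{x, y} \<in> E"
    and f: "proper_on (E - {{x, y}}) f" "f ` (E - {{x, y}}) \<subseteq> {..<k}"
  shows "\<exists>g. proper_on E g \<and> g ` E \<subseteq> {..<k}"
proof -
  let ?F = "E - {{x, y}}"
  have twoF: "\<forall>e \<in> ?F. card e = 2" using two by simp
  have missF: "\<exists>c<k. missing ?F f z c" for z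
  proof -
    have "card {e \<in> ?F. z \<in> e} \<le> card {e \<in> E. z \<in> e}" using fin by (intro card_mono) auto
    then have "card {e \<in> ?F. z \<in> e} < k" using deg[of z] by simp
    then show ?thesis using exists_missing[of ?F z k f] fin by blast
  qed
  have nx: "z \<noteq> x" if "{x, z} \<in> E" for z using that two by fastforce
  define P where "P ys \<longleftrightarrow> fan E f x ys \<and> hd ys = y" for ys
  have "P [y]" using xy by (simp add: P_def fan_def)
  moreover have "length ys \<le> card (\<Union>E)" if "P ys" for ys
  proof -
    have "set ys \<subseteq> \<Union>E" "distinct ys" using that by (auto simp: P_def fan_def)
    moreover have "finite (\<Union>E)" using fin two by (fastforce intro: finite_Union card_ge_0_finite)
    ultimately show ?thesis using card_mono[of "\<Union>E" "set ys"] by (simp add: distinct_card)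
  qed
  \<comment> \<open>Distinctness bounds the length of a fan, so a longest one exists.\<close>
  ultimately obtain ys where ys: "P ys" and max: "\<And>zs. P zs \<Longrightarrow> length zs \<le> length ys"
    using ex_has_greatest_nat[of P "[y]" length "Suc (card (\<Union>E))"] by (auto simp: less_Suc_eq_le)
  have fan: "ys \<noteq> []" "distinct ys" "\<And>z. z \<in> set ys \<Longrightarrow> {x, z} \<in> E" "hd ys = y"
    "\<And>i. Suc i < length ys \<Longrightarrow> missing ?F f (ys ! i) (f {x, ys ! Suc i})"
    using ys by (auto simp: P_def fan_def)
  obtain d where d: "d < k" "missing ?F f (last ys) d" using missF by blast
  show ?thesis
  proof (cases "missing ?F f x d")
    case True
    then show ?thesis
      using fan_shift[of E x ys f "{..<k}" d] two f d ys by (simp add: P_def)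
  next
    case False
    then obtain v where v: "{x, v} \<in> ?F" "f {x, v} = d" using not_missingE[OF twoF False] by blast
    \<comment> \<open>Otherwise \<open>v\<close> could be appended, since \<open>last ys\<close>
      misses the colour \<open>d\<close> of \<open>{x, v}\<close>.\<close>
    have "v \<in> set ys"
    proof (rule ccontr)
      assume new: "v \<notin> set ys"
      have "P (ys @ [v])"
        unfolding P_def fan_def
      proof (intro conjI allI impI)
        fix i assume "Suc i < length (ys @ [v])"
        then consider "Suc i < length ys" | "Suc i = length ys" by fastforce
        then show "missing (E - {{x, hd (ys @ [v])}}) f ((ys @ [v]) ! i) (f {x, (ys @ [v]) ! Suc i})"
        proof cases
          case 1
          then show ?thesis using fan(1,4) fan(5)[OF 1] by (simp add: nth_append)
        next
          case 2
          then have "i = length ys - 1" by simp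
          then show ?thesis using 2 fan(1,4) d(2) v(2) by (simp add: nth_append last_conv_nth)
        qed
      qed (use fan v new in auto)
      then show False using max by fastforce
    qed
    then obtain n where n: "n < length ys" "ys ! n = v" by (auto simp: in_set_conv_nth)
    \<comment> \<open>\<open>{x, y}\<close> is not in \<open>?F\<close>, so \<open>v\<close> is not
      the head; its predecessor \<open>u\<close> misses \<open>d\<close> by the fan
      condition.\<close>
    have "v \<noteq> y" using v(1) by auto
    then have "n \<noteq> 0" using fan(1,4) n(2) by (metis hd_conv_nth)
    then obtain j where j: "Suc j < length ys" "ys ! Suc j = v"
      using n by (cases n) auto
    define u where "u = ys ! j"
    have ud: "missing ?F f u d" using fan(5)[OF j(1)] j(2) v(2) by (simp add: u_def)
    have ux: "u \<noteq> x" using fan(3) j(1) nx by (simp add: u_def)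
    have lx: "last ys \<noteq> x" using fan(1,3) nx by simp
    have ul: "u \<noteq> last ys"
      using fan(1,2) j(1) by (auto simp: u_def last_conv_nth nth_eq_iff_index_eq)
    obtain c where c: "c < k" "missing ?F f x c" using missF by blast
    obtain S where S: "x \<in> S"
      and closed: "\<And>e. \<lbrakk>e \<in> ?F; f e \<in> {c, d}; e \<inter> S \<noteq> {}\<rbrakk> \<Longrightarrow> e \<subseteq> S"
      and ends: "\<And>y z. \<lbrakk>y \<in> S; z \<in> S; y \<noteq> x; z \<noteq> x; missing ?F f y d; missing ?F f z d\<rbrakk> \<Longrightarrow> y = z"
      using kempe_chain[OF twoF f(1) c(2)] by metis
    let ?g = "kempe_swap c d S f"
    have g: "proper_on ?F ?g" using closed f(1) by (rule proper_on_kempe_swap)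
    have gC: "?g ` ?F \<subseteq> {..<k}"
      using f(2) c(1) d(1) by (auto simp: kempe_swap_def transpose_def)
    have miss: "missing ?F ?g z a \<longleftrightarrow> missing ?F f z (if z \<in> S then transpose c d a else a)" for z a
      using closed by (rule missing_kempe_swap)
    have gx: "missing ?F ?g x d" using S c(2) by (simp add: miss)
    \<comment> \<open>No coloured spoke has colour \<open>c\<close>, and only the spoke to
      \<open>v\<close> can have colour \<open>d\<close>. That one becomes \<open>c\<close>, so its
      predecessor \<open>u\<close> must now miss \<open>c\<close>, which the swap ensures when
      \<open>u\<close> is in \<open>S\<close>.\<close>
    have keep: "missing ?F ?g (ys ! i) (?g {x, ys ! Suc i})"
      if i: "Suc i < length ys" and iS: "i = j \<Longrightarrow> u \<in> S" for i
    proof -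
      let ?v = "ys ! Suc i"
      have "?v \<noteq> hd ys" using fan(1,2) i by (simp add: hd_conv_nth nth_eq_iff_index_eq)
      then have vF: "{x, ?v} \<in> ?F"
        using fan(3)[of ?v] fan(4) i by (auto simp: doubleton_eq_iff)
      then have nc: "f {x, ?v} \<noteq> c" using c(2) by (auto simp: missing_def)
      have ge: "?g {x, ?v} = transpose c d (f {x, ?v})" using S by (simp add: kempe_swap_def)
      show ?thesis
      proof (cases "f {x, ?v} = d")
        case True
        then have "?v = v" using proper_on_inj[OF f(1) vF v(1)] v(2) by simp
        then have "i = j" using fan(2) i j by (metis Suc_inject nth_eq_iff_index_eq)
        then show ?thesis using True iS ge ud by (simp add: miss u_def)
      next
        case False
        then show ?thesis using nc ge fan(5)[OF i] by (simp add: miss)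
      qed
    qed
    show ?thesis
    proof (cases "u \<in> S")
      case True
      \<comment> \<open>\<open>u\<close> and \<open>last ys\<close> both miss \<open>d\<close>, so
        the chain cannot contain both. The whole fan survives, and its last vertex still misses
        \<open>d\<close>.\<close>
      then have "last ys \<notin> S" using ends ux lx ul ud d(2) by blast
      then have "missing ?F ?g (last ys) d" using d(2) by (simp add: miss)
      moreover have "fan E ?g x ys" using fan keep True by (simp add: fan_def)
      ultimately show ?thesis
        using fan_shift[of E x ys ?g "{..<k}" d] two g gC gx d(1) fan(4) by simp
    next
      case False
      \<comment> \<open>Cutting the fan after \<open>u\<close> drops index \<open>j\<close>, the
        only one that the swap can spoil; \<open>u\<close>, being outside \<open>S\<close>, still
        misses \<open>d\<close>.\<close>
      let ?zs = "take (Suc j) ys"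
      have hd: "hd ?zs = y" using fan(1,4) by (simp add: hd_take)
      have last: "last ?zs = u" using j(1) by (simp add: u_def take_Suc_conv_app_nth)
      have "missing ?F ?g u d" using ud False by (simp add: miss)
      moreover have "fan E ?g x ?zs"
        unfolding fan_def hd
      proof (intro conjI ballI allI impI)
        fix i assume "Suc i < length ?zs"
        then show "missing ?F ?g (?zs ! i) (?g {x, ?zs ! Suc i})"
          using keep[of i] j(1) by simp
      qed (use fan(1-3) in \<open>auto dest: in_set_takeD\<close>)
      ultimately show ?thesis
        using fan_shift[of E x ?zs ?g "{..<k}" d] two g gC gx d(1) hd last by simp
    qed
  qed
qed

text \<open>Edges are inserted one by one: the valency bound passes to subsets, and
  \<open>extend_coloring\<close> may recolour the earlier edges.\<close>

theorem vizing:
  assumes "finite E" "\<forall>e \<in> E. card e = 2" "\<And>z. card {e \<in> E. z \<in> e} < k"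
  shows "\<exists>f :: 'a set \<Rightarrow> nat. proper_on E f \<and> f ` E \<subseteq> {..<k}"
  using assms
proof (induction E rule: finite_induct)
  case empty
  then show ?case by (simp add: proper_on_def)
next
  case (insert e E)
  have "card {e \<in> E. z \<in> e} < k" for z
  proof -
    have "card {e \<in> E. z \<in> e} \<le> card {e' \<in> insert e E. z \<in> e'}"
      using insert.hyps by (intro card_mono) auto
    then show ?thesis using insert.prems(2)[of z] by simp
  qed
  then obtain f :: "'a set \<Rightarrow> nat" where f: "proper_on E f" "f ` E \<subseteq> {..<k}"
    using insert by auto
  obtain x y where e: "e = {x, y}" using insert.prems(1) by (auto simp: card_2_iff)
  then have "insert e E - {{x, y}} = E" using insert.hyps by simp
  then show ?case
    using extend_coloring[of "insert e E" k x y f] insert.hyps insert.prems f e by simp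
qed

section \<open>Chromatic index\<close>

lemma proper_edge_coloring_iff: "proper_edge_coloring G f \<longleftrightarrow> proper_on (edges G) f"
  by (simp add: proper_edge_coloring_def proper_on_def)

lemma simple_graph_finite_edges: "simple_graph G \<Longrightarrow> finite (edges G)"
  by (rule finite_subset[of _ "Pow (verts G)"]) (auto simp: simple_graph_def)

lemma valency_le_max_valency:
  "\<lbrakk>finite (verts G); x \<in> verts G\<rbrakk> \<Longrightarrow> valency G x \<le> max_valency G"
  by (simp add: max_valency_def)

text \<open>\<open>LEAST\<close> needs a witness: numbering the finitely many edges gives them
  pairwise different colours.\<close>

lemma edge_colorable_chromatic_index:
  assumes "simple_graph G"
  shows "edge_colorable G (chromatic_index G)"
proof -
  obtain c n where c: "edges G = c ` {i::nat. i < n}" "inj_on c {i. i < n}"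
    using simple_graph_finite_edges[OF assms] by (metis finite_imp_nat_seg_image_inj_on)
  let ?f = "inv_into {i. i < n} c"
  have "inj_on ?f (edges G)" using c by (simp add: inj_on_inv_into)
  then have "proper_edge_coloring G ?f"
    unfolding proper_edge_coloring_def by (meson inj_onD)
  moreover have "?f ` edges G \<subseteq> {..<n}" using c by auto
  ultimately have "edge_colorable G n" unfolding edge_colorable_def by blast
  then show ?thesis unfolding chromatic_index_def by (rule LeastI)
qed

lemma max_valency_le:
  assumes "simple_graph G" "edge_colorable G k"
  shows "max_valency G \<le> k"
proof -
  obtain f :: "'a set \<Rightarrow> nat" where f: "proper_edge_coloring G f" "f ` edges G \<subseteq> {..<k}"
    using assms(2) by (auto simp: edge_colorable_def)
  have "valency G x \<le> k" for x
  proof -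
    let ?E = "{e \<in> edges G. x \<in> e}"
    have "inj_on f ?E" using f(1) by (auto simp: proper_edge_coloring_def inj_on_def)
    moreover have "f ` ?E \<subseteq> {..<k}" using f(2) by auto
    ultimately have "card ?E \<le> card {..<k}" using card_inj_on_le by blast
    then show ?thesis by (simp add: valency_def)
  qed
  then show ?thesis using assms(1) by (simp add: max_valency_def simple_graph_def)
qed

text \<open>The maximum valency is always a lower bound for the chromatic index, so a colouring with
  that many colours decides class I.\<close>

lemma class_I_iff:
  assumes "simple_graph G"
  shows "class_I G \<longleftrightarrow> edge_colorable G (max_valency G)"
proof
  assume "class_I G"
  then show "edge_colorable G (max_valency G)"
    using edge_colorable_chromatic_index[OF assms] by (simp add: class_I_def)
next
  assume "edge_colorable G (max_valency G)"
  then have "chromatic_index G \<le> max_valency G"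
    unfolding chromatic_index_def by (rule Least_le)
  then show "class_I G"
    using max_valency_le[OF assms edge_colorable_chromatic_index[OF assms]]
    by (simp add: class_I_def)
qed

lemma edge_colorable_mono: "\<lbrakk>edge_colorable G k; k \<le> l\<rbrakk> \<Longrightarrow> edge_colorable G l"
  unfolding edge_colorable_def by (meson lessThan_subset_iff subset_trans)

text \<open>\<open>vizing\<close> wants the bound at every element of the type; \<open>0 < k\<close>
  supplies it outside \<open>verts G\<close>.\<close>

corollary edge_colorable_vizing:
  assumes "simple_graph G" "\<And>x. x \<in> verts G \<Longrightarrow> valency G x < k" "0 < k"
  shows "edge_colorable G k"
proof -
  have "card {e \<in> edges G. x \<in> e} < k" for x
  proof (cases "x \<in> verts G")
    case True
    then show ?thesis using assms(2) by (simp add: valency_def)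
  next
    case False
    then have "{e \<in> edges G. x \<in> e} = {}" using assms(1) by (auto simp: simple_graph_def)
    then show ?thesis using assms(3) by (simp only: card.empty)
  qed
  then show ?thesis
    using vizing[of "edges G" k] assms(1) simple_graph_finite_edges[OF assms(1)]
    by (auto simp: edge_colorable_def proper_edge_coloring_iff simple_graph_def)
qed

section \<open>Generalized truncations\<close>

lemma constituent_edge_subset:
  assumes "constituents X con" "v \<in> mverts X" "e \<in> edges (con v)"
  shows "e \<subseteq> cluster X v" "card e = 2"
  using assms by (auto simp: constituents_def simple_graph_def)

text \<open>The fundamental matching adds exactly one edge at \<open>x\<close>, and the label of
  \<open>x\<close> keeps all other constituents away from it.\<close>

lemma valency_TR:
  assumes X: "multigraph X" and con: "constituents X con"
    and v: "v \<in> mverts X" and x: "x \<in> verts (con v)"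
  shows "valency (TR X con) x = Suc (valency (con v) x)"
proof -
  obtain e where e: "x = (e, v)" "e \<in> medges X" "v \<in> mends X e"
    using con v x by (auto simp: constituents_def cluster_def)
  have other: "w = v" if "w \<in> mverts X" "d \<in> edges (con w)" "x \<in> d" for d w
    using constituent_edge_subset(1)[OF con that(1,2)] that(3) e(1) by (auto simp: cluster_def)
  have "{d \<in> edges (TR X con). x \<in> d} = insert (matching_edge X e) {d \<in> edges (con v). x \<in> d}"
  proof
    show "{d \<in> edges (TR X con). x \<in> d} \<subseteq> insert (matching_edge X e) {d \<in> edges (con v). x \<in> d}"
      using other e(1) by (auto simp: TR_def fundamental_matching_def matching_edge_def)
    show "insert (matching_edge X e) {d \<in> edges (con v). x \<in> d} \<subseteq> {d \<in> edges (TR X con). x \<in> d}"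
      using v e by (auto simp: TR_def fundamental_matching_def matching_edge_def)
  qed
  \<comment> \<open>The ends of a matching edge share the first component and the vertices of a
    cluster share the second, so a common edge would have at most one vertex.\<close>
  moreover have "matching_edge X e \<notin> edges (con v)"
  proof
    assume a: "matching_edge X e \<in> edges (con v)"
    have "matching_edge X e \<subseteq> {(e, v)}"
      using constituent_edge_subset(1)[OF con v a] by (auto simp: cluster_def matching_edge_def)
    then have "card (matching_edge X e) \<le> card {(e, v)}" by (intro card_mono) auto
    then show False using constituent_edge_subset(2)[OF con v a] by simp
  qed
  moreover have "finite (edges (con v))"
    using con v by (intro simple_graph_finite_edges) (simp add: constituents_def)
  ultimately show ?thesis by (simp add: valency_def)
qed

text \<open>Clusters are disjoint, so all constituents can share the colours below \<open>k\<close>;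
  colour \<open>k\<close> goes to the matching.\<close>

lemma edge_colorable_TR:
  assumes con: "constituents X con"
    and col: "\<And>v. v \<in> mverts X \<Longrightarrow> edge_colorable (con v) k"
  shows "edge_colorable (TR X con) (Suc k)"
proof -
  obtain c where c: "\<And>v. v \<in> mverts X \<Longrightarrow> proper_edge_coloring (con v) (c v)"
    "\<And>v. v \<in> mverts X \<Longrightarrow> c v ` edges (con v) \<subseteq> {..<k}"
    using col unfolding edge_colorable_def by metis
  \<comment> \<open>All ends of an edge of \<open>con v\<close> are labelled \<open>v\<close>, so
    any chosen end tells which colouring to use.\<close>
  define f where "f e = (if e \<in> fundamental_matching X then k else c (snd (SOME x. x \<in> e)) e)" for e
  have snd_const: "snd x = v" if "v \<in> mverts X" "e \<in> edges (con v)" "x \<in> e" for v e x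
    using constituent_edge_subset(1)[OF con that(1,2)] that(3) by (auto simp: cluster_def)
  have f_con: "f e = c v e"
    if "v \<in> mverts X" "e \<in> edges (con v)" "e \<notin> fundamental_matching X" for v e
  proof -
    have "e \<noteq> {}" using constituent_edge_subset(2)[OF con that(1,2)] by auto
    then have "(SOME x. x \<in> e) \<in> e" by (simp add: some_in_eq)
    then show ?thesis using snd_const that by (simp add: f_def)
  qed
  have f_lt: "f e < k" if "v \<in> mverts X" "e \<in> edges (con v)" "e \<notin> fundamental_matching X" for v e
    using f_con[OF that] c(2)[OF that(1)] that(2) by auto
  have cases: "e \<in> fundamental_matching X \<or>
      (e \<notin> fundamental_matching X \<and> (\<exists>v\<in>mverts X. e \<in> edges (con v)))"
    if "e \<in> edges (TR X con)" for e
    using that by (auto simp: TR_def)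
  have "f d \<noteq> f e"
    if de: "d \<in> edges (TR X con)" "e \<in> edges (TR X con)" "d \<noteq> e" "d \<inter> e \<noteq> {}" for d e
  proof (cases "d \<in> fundamental_matching X \<or> e \<in> fundamental_matching X")
    case True
    have "\<not> (d \<in> fundamental_matching X \<and> e \<in> fundamental_matching X)"
      using de(3,4) by (auto simp: fundamental_matching_def matching_edge_def)
    with True have "f d = k \<and> f e < k \<or> f e = k \<and> f d < k"
      using cases[OF de(1)] cases[OF de(2)] f_lt by (metis f_def)
    then show ?thesis by auto
  next
    case False
    then obtain v w where v: "v \<in> mverts X" "d \<in> edges (con v)"
      and w: "w \<in> mverts X" "e \<in> edges (con w)"
      using cases de(1,2) by metis
    have "v = w" using snd_const[OF v] snd_const[OF w] de(4) by blast
    then show ?thesis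
      using f_con v w False de(3,4) c(1)[OF v(1)] by (simp add: proper_edge_coloring_def)
  qed
  then have "proper_edge_coloring (TR X con) f"
    by (simp add: proper_edge_coloring_def)
  moreover have "f ` edges (TR X con) \<subseteq> {..<Suc k}"
  proof
    fix i assume "i \<in> f ` edges (TR X con)"
    then obtain e where e: "e \<in> edges (TR X con)" "i = f e" by blast
    then show "i \<in> {..<Suc k}" using cases[OF e(1)] f_lt by (auto simp: f_def less_Suc_eq)
  qed
  ultimately show ?thesis unfolding edge_colorable_def by blast
qed

theorem theorem6p1:
  fixes X :: "('v, 'e) mgraph"
    and con :: "'v \<Rightarrow> ('e \<times> 'v) graph"
    and \<Delta> :: nat
  assumes "multigraph X"
    and "no_isolated_vertices X"
    and "constituents X con"
    and "\<Delta> = max_valency (TR X con)"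
    and "\<forall>v \<in> mverts X.
           (\<exists>x \<in> verts (con v). valency (TR X con) x = \<Delta>) \<longrightarrow> class_I (con v)"
  shows "class_I (TR X con)"
proof -
  have simple: "simple_graph (TR X con)" using assms(1,3) by (rule simple_graph_TR)
  have sc: "simple_graph (con v)" if "v \<in> mverts X" for v
    using assms(3) that by (simp add: constituents_def)
  have val: "Suc (valency (con v) x) = valency (TR X con) x" "valency (TR X con) x \<le> \<Delta>"
    if "v \<in> mverts X" "x \<in> verts (con v)" for v x
  proof -
    show "Suc (valency (con v) x) = valency (TR X con) x"
      using valency_TR[OF assms(1,3) that] by simp
    have "x \<in> verts (TR X con)"
      using assms(3) that by (auto simp: verts_TR[OF assms(1)] constituents_def)
    then show "valency (TR X con) x \<le> \<Delta>"
      using simple assms(4) valency_le_max_valency by (auto simp: simple_graph_def)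
  qed
  have col: "edge_colorable (con v) (\<Delta> - 1)" if v: "v \<in> mverts X" for v
  proof (cases "\<exists>x \<in> verts (con v). valency (TR X con) x = \<Delta>")
    case True
    then have "edge_colorable (con v) (max_valency (con v))"
      using assms(5) v class_I_iff[OF sc[OF v]] by blast
    moreover have "valency (con v) x \<le> \<Delta> - 1" if "x \<in> verts (con v)" for x
      using val[OF v that] by simp
    then have "max_valency (con v) \<le> \<Delta> - 1"
      using sc[OF v] by (simp add: max_valency_def simple_graph_def)
    ultimately show ?thesis by (rule edge_colorable_mono)
  next
    case False
    have lt: "valency (con v) x < \<Delta> - 1" if "x \<in> verts (con v)" for x
      using val[OF v that] False that by fastforce
    \<comment> \<open>As \<open>v\<close> is not isolated, its cluster is nonempty; a valency below
      \<open>\<Delta> - 1\<close> then makes \<open>\<Delta> - 1\<close> positive, as Vizing's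
      theorem requires here.\<close>
    obtain x where "x \<in> verts (con v)"
      using assms(2,3) v by (fastforce simp: no_isolated_vertices_def constituents_def cluster_def)
    then have "0 < \<Delta> - 1" using lt by fastforce
    then show ?thesis using edge_colorable_vizing[OF sc[OF v]] lt by blast
  qed
  have "edge_colorable (TR X con) \<Delta>"
  \<comment> \<open>Without vertices \<open>\<Delta>\<close> is \<open>0\<close> and no colour can
    be reserved, but there is no edge to colour either.\<close>
  proof (cases "mverts X = {}")
    case True
    then have "medges X = {}" using assms(1) by (fastforce simp: multigraph_def)
    then have "edges (TR X con) = {}" using True by (simp add: TR_def fundamental_matching_def)
    then show ?thesis by (simp add: edge_colorable_def proper_edge_coloring_def)
  next
    case False
    then obtain v x where "v \<in> mverts X" "x \<in> verts (con v)"
      using assms(2,3) by (fastforce simp: no_isolated_vertices_def constituents_def cluster_def)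
    \<comment> \<open>Positivity turns \<open>Suc (\<Delta> - 1)\<close> into
      \<open>\<Delta>\<close>.\<close>
    then have "0 < \<Delta>" using val by fastforce
    then show ?thesis using edge_colorable_TR[OF assms(3) col] by simp
  qed
  then show ?thesis using class_I_iff[OF simple] assms(4) by simp
qed

end
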